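(* Let $(X,d)$ be a metric space, let $D_n\subset X$ and $f_n:D_n\to D_{n+1}$ be maps for $n\ge 0$, and consider the non-autonomous system $x_{n+1}=f_n(x_n)$, $n\ge 0$. Let $V$ be an infinite totally invariant set of the system. Assume that $\{f_n\}_{n=0}^\infty$ converges (pointwise) to a map $f$ in $V$, and that $f_n$ for all $n\ge 0$ and $f$ are continuous in $V$. If the system is topologically transitive in $V$ and $P(f_{0,\infty})\cap V$ is dense in $V$, then the system is sensitive in $V$.
   Context: Notation: $f_0^0=\mathrm{id}$ and $f_0^n=f_{n-1}\circ\cdots\circ f_0$ on $D_0$ for $n\ge1$. A nonempty set $V\subset\bigcap_{n=0}^\infty D_n$ is a totally invariant set of the system if $f_0^n(V)\subset V$ for all $n\ge 0$. "Converges to $f$ in $V$" means $f:V\to X$ and $f_n(x)\to f(x)$ for each $x\in V$; "continuous in $V$" refers to the map restricted to $V$. A point $p\in D_0$ is $k$-periodic ($k\ge 1$) if $f_0^{n+k}(p)=f_0^n(p)$ for all $n\ge 0$; $P(f_{0,\infty})$ is the set of all periodic points (i.e., $k$-periodic for some $k\geq 1$). The system is topologically transitive in a nonempty $V\subset D_0$ if for any two nonempty relatively open subsets $U_0,V_0$ of $V$ there is an integer $n\ge 1$ with $f_0^n(U_0)\cap V_0\ne\emptyset$. The system is sensitive in a nonempty $V\subset D_0$ if there is a constant $\delta_0>0$ such that for every $x_0\in V$ and every neighborhood $U$ of $x_0$ there exist $y_0\in V\cap U$ and a positive integer $n$ with $d(f_0^n(x_0),f_0^n(y_0))>\delta_0$.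 *)

theory Defs
  imports "HOL-Analysis.Analysis"
begin

text \<open>
  The maps \<open>f\<^sub>n : D\<^sub>n \<rightarrow> D\<^sub>n\<^sub>+\<^sub>1\<close> are represented by total functions \<open>f n\<close>; their values outside
  \<open>D n\<close> are irrelevant, since \<open>iter0 f n = f\<^sub>0\<^sup>n\<close> is only applied to points of \<open>D 0\<close> and \<open>f n\<close> only to
  points of \<open>D n\<close>.
\<close>

definition nonautonomous_system :: "(nat \<Rightarrow> 'a set) \<Rightarrow> (nat \<Rightarrow> 'a \<Rightarrow> 'a) \<Rightarrow> bool" where
  "nonautonomous_system D f \<longleftrightarrow> (\<forall>n. f n \<in> D n \<rightarrow> D (Suc n))"

primrec iter0 :: "(nat \<Rightarrow> 'a \<Rightarrow> 'a) \<Rightarrow> nat \<Rightarrow> 'a \<Rightarrow> 'a" where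
  "iter0 f 0 = id"
| "iter0 f (Suc n) = f n \<circ> iter0 f n"

definition totally_invariant ::
  "(nat \<Rightarrow> 'a set) \<Rightarrow> (nat \<Rightarrow> 'a \<Rightarrow> 'a) \<Rightarrow> 'a set \<Rightarrow> bool" where
  "totally_invariant D f V \<longleftrightarrow>
     V \<noteq> {} \<and> V \<subseteq> (\<Inter>n. D n) \<and> (\<forall>n. iter0 f n ` V \<subseteq> V)"

definition k_periodic_point ::
  "(nat \<Rightarrow> 'a set) \<Rightarrow> (nat \<Rightarrow> 'a \<Rightarrow> 'a) \<Rightarrow> nat \<Rightarrow> 'a \<Rightarrow> bool" where
  "k_periodic_point D f k p \<longleftrightarrow>
     k \<ge> 1 \<and> p \<in> D 0 \<and> (\<forall>n. iter0 f (n + k) p = iter0 f n p)"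

definition periodic_points :: "(nat \<Rightarrow> 'a set) \<Rightarrow> (nat \<Rightarrow> 'a \<Rightarrow> 'a) \<Rightarrow> 'a set" where
  "periodic_points D f = {p. \<exists>k. k_periodic_point D f k p}"

definition topologically_transitive_in ::
  "(nat \<Rightarrow> 'a::topological_space set) \<Rightarrow> (nat \<Rightarrow> 'a \<Rightarrow> 'a) \<Rightarrow> 'a set \<Rightarrow> bool" where
  "topologically_transitive_in D f V \<longleftrightarrow>
     V \<noteq> {} \<and> V \<subseteq> D 0 \<and>
     (\<forall>U0 V0. openin (top_of_set V) U0 \<and> U0 \<noteq> {} \<and> openin (top_of_set V) V0 \<and> V0 \<noteq> {} \<longrightarrow>
        (\<exists>n\<ge>1. iter0 f n ` U0 \<inter> V0 \<noteq> {}))"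

definition sensitive_in ::
  "(nat \<Rightarrow> 'a::metric_space set) \<Rightarrow> (nat \<Rightarrow> 'a \<Rightarrow> 'a) \<Rightarrow> 'a set \<Rightarrow> bool" where
  "sensitive_in D f V \<longleftrightarrow>
     V \<noteq> {} \<and> V \<subseteq> D 0 \<and>
     (\<exists>\<delta>>0. \<forall>x\<in>V. \<forall>U. x \<in> interior U \<longrightarrow>
        (\<exists>y\<in>V \<inter> U. \<exists>n\<ge>1. dist (iter0 f n x) (iter0 f n y) > \<delta>))"

end

theory Submission
  imports Defs
begin

text \<open>
  Along the orbit of a periodic point \<open>p\<close> the maps \<open>f\<^sub>n\<close> recur: \<open>f\<^sub>n\<^sub>+\<^sub>j\<^sub>k\<close> sends \<open>f\<^sub>0\<^sup>n(p)\<close> to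
  \<open>f\<^sub>0\<^sup>n\<^sup>+\<^sup>1(p)\<close> for every \<open>j\<close>, so the pointwise limit \<open>g\<close> does the same. By density of the periodic
  points and continuity, \<open>g \<circ> f\<^sub>0\<^sup>n = f\<^sub>0\<^sup>n\<^sup>+\<^sup>1\<close> on all of \<open>V\<close>. Hence \<open>g\<close> maps \<open>V\<close> into itself and
  \<open>f\<^sub>0\<^sup>n = g\<^sup>n\<close> on \<open>V\<close>: the system is autonomous there, and the theorem reduces to that of Banks,
  Brooks, Cairns, Davis and Stacey for the single map \<open>g\<close>.
\<close>

lemma funpow_mult_fixed:
  assumes "(g ^^ k) p = p"
  shows "(g ^^ (k * j)) p = p"
  using assms by (induction j) (auto simp: funpow_add)

lemma finite_range_funpow:
  assumes "k \<ge> 1" "(g ^^ k) p = p"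
  shows "finite (range (\<lambda>n. (g ^^ n) p))"
proof (rule finite_subset)
  show "range (\<lambda>n. (g ^^ n) p) \<subseteq> (\<lambda>n. (g ^^ n) p) ` {..<k}"
  proof
    fix y assume "y \<in> range (\<lambda>n. (g ^^ n) p)"
    then obtain n where "y = (g ^^ n) p" by auto
    then have "y = (g ^^ (n mod k)) p"
      using funpow_mod_eq[OF assms(2)] by metis
    then show "y \<in> (\<lambda>n. (g ^^ n) p) ` {..<k}"
      using assms(1) by auto
  qed
qed simp

text \<open>From any point of its orbit, \<open>q\<close> is reached again by iterating
  \<open>g\<close> further. A point common to both orbits would therefore carry the orbit of
  \<open>p\<close> to \<open>q\<close>.\<close>

lemma disjoint_periodic_orbits:
  assumes "k \<ge> 1" "(g ^^ k) q = q" "q \<notin> range (\<lambda>n. (g ^^ n) p)"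
  shows "range (\<lambda>n. (g ^^ n) p) \<inter> range (\<lambda>n. (g ^^ n) q) = {}"
proof (rule ccontr)
  assume "\<not> ?thesis"
  then obtain a b where ab: "(g ^^ a) p = (g ^^ b) q" by auto
  \<comment> \<open>This keeps the truncated subtraction in \<open>k * b - b\<close> exact: that
    many further steps lead from \<open>(g ^^ b) q\<close> back to \<open>q\<close>.\<close>
  have "b \<le> k * b" using assms(1) by simp
  then have "(g ^^ (k * b - b + b)) q = q"
    using funpow_mult_fixed[OF assms(2)] by simp
  then have "q = (g ^^ (k * b - b + a)) p"
    using ab by (simp add: funpow_add)
  then show False using assms(3) by blast
qed

lemma funpow_in:
  assumes "g ` V \<subseteq> V" "x \<in> V"
  shows "(g ^^ n) x \<in> V"
  using assms by (induction n) auto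

lemma continuous_on_funpow:
  fixes g :: "'a::topological_space \<Rightarrow> 'a"
  assumes "continuous_on V g" "g ` V \<subseteq> V"
  shows "continuous_on V (g ^^ n)"
proof (induction n)
  case (Suc n)
  have "(g ^^ n) ` V \<subseteq> V" using funpow_in[OF assms(2)] by blast
  then show ?case
    using continuous_on_compose[OF Suc continuous_on_subset[OF assms(1)]] by simp
qed (simp add: id_def)

lemma openin_ex_dense:
  assumes "V \<subseteq> closure (P \<inter> V)" "openin (top_of_set V) S" "S \<noteq> {}"
  shows "\<exists>p\<in>P. p \<in> S"
proof -
  obtain T where T: "open T" "S = V \<inter> T" using assms(2) by (auto simp: openin_open)
  then have "T \<inter> closure (P \<inter> V) \<noteq> {}" using assms by blast
  then have "T \<inter> (P \<inter> V) \<noteq> {}" using T(1) open_Int_closure_eq_empty by blast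
  then show ?thesis using T by blast
qed

text \<open>Periodic orbits are finite, hence closed, and cannot exhaust the infinite set
  \<open>V\<close>. Density then gives a second periodic point off the first orbit, and two disjoint
  finite orbits lie at positive distance.\<close>

lemma ex_separated_periodic_orbits:
  fixes g :: "'a::metric_space \<Rightarrow> 'a"
  assumes "infinite V"
    and dense: "V \<subseteq> closure (P \<inter> V)"
    and per: "\<And>p. p \<in> P \<inter> V \<Longrightarrow> \<exists>k\<ge>1. (g ^^ k) p = p"
  obtains d p q where "d > 0" "p \<in> V" "q \<in> V"
    "\<And>m n. dist ((g ^^ m) p) ((g ^^ n) q) \<ge> d"
proof -
  have "V \<noteq> {}" using assms(1) by auto
  then obtain p where p: "p \<in> P" "p \<in> V"
    using openin_ex_dense[OF dense openin_subtopology_self] by blast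
  let ?A = "range (\<lambda>n. (g ^^ n) p)"
  have A: "finite ?A" using per p finite_range_funpow by (metis IntI)
  have "openin (top_of_set V) (V - ?A)"
    using finite_imp_closed[OF A] by (simp add: Diff_eq openin_open_Int open_Compl)
  moreover have "V - ?A \<noteq> {}" using A assms(1) by (metis Diff_infinite_finite finite.emptyI)
  ultimately obtain q where q: "q \<in> P" "q \<in> V" "q \<notin> ?A"
    using openin_ex_dense[OF dense] by blast
  let ?B = "range (\<lambda>n. (g ^^ n) q)"
  obtain k where k: "k \<ge> 1" "(g ^^ k) q = q" using per q by blast
  have B: "finite ?B" using finite_range_funpow[OF k] .
  have "?A \<inter> ?B = {}" using disjoint_periodic_orbits[OF k q(3)] .
  moreover define d where "d = Min ((\<lambda>(a, b). dist a b) ` (?A \<times> ?B))"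
  ultimately have "d > 0" "\<And>a b. a \<in> ?A \<Longrightarrow> b \<in> ?B \<Longrightarrow> d \<le> dist a b"
    using A B by (auto simp: Min_gr_iff intro!: Min_le)
  with p q show ?thesis by (intro that[of d p q]) auto
qed

text \<open>Near \<open>x\<close> there are a periodic point \<open>p\<close> and, by transitivity,
  a point \<open>y\<close> whose orbit later follows an orbit far from \<open>x\<close>. At a
  suitable multiple of the period, \<open>p\<close> is back near \<open>x\<close> while
  \<open>y\<close> is far away, so the orbit of \<open>x\<close> must separate from one of
  them.\<close>

theorem Banks_sensitivity:
  fixes g :: "'a::metric_space \<Rightarrow> 'a"
  assumes inf: "infinite V"
    and cont: "continuous_on V g"
    and inv: "g ` V \<subseteq> V"
    and trans: "\<And>S T. openin (top_of_set V) S \<Longrightarrow> S \<noteq> {} \<Longrightarrow> openin (top_of_set V) T \<Longrightarrow> T \<noteq> {} \<Longrightarrow>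
        \<exists>n. (g ^^ n) ` S \<inter> T \<noteq> {}"
    and dense: "V \<subseteq> closure (P \<inter> V)"
    and per: "\<And>p. p \<in> P \<inter> V \<Longrightarrow> \<exists>k\<ge>1. (g ^^ k) p = p"
  shows "\<exists>\<delta>>0. \<forall>x\<in>V. \<forall>U. x \<in> interior U \<longrightarrow>
    (\<exists>y\<in>V \<inter> U. \<exists>n\<ge>1. dist ((g ^^ n) x) ((g ^^ n) y) > \<delta>)"
proof -
  obtain d q1 q2 where d: "d > 0" and q12: "q1 \<in> V" "q2 \<in> V"
    and sep: "\<And>m n. dist ((g ^^ m) q1) ((g ^^ n) q2) \<ge> d"
    using ex_separated_periodic_orbits[OF inf dense per] by blast
  \<comment> \<open>Here \<open>4 * \<delta>\<close> is half of \<open>d\<close>, so no point is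
    within \<open>4 * \<delta>\<close> of both orbits. Of this distance, \<open>p\<close> and
    \<open>y\<close> each cost one \<delta>, and the remaining \<open>2 * \<delta>\<close> is split
    by comparison with the orbit of \<open>x\<close>.\<close>
  define \<delta> where "\<delta> = d / 8"
  have \<delta>: "\<delta> > 0" using d by (simp add: \<delta>_def)
  have far: "\<exists>q\<in>V. \<forall>n. dist x ((g ^^ n) q) \<ge> 4 * \<delta>" for x
  proof (rule ccontr)
    assume "\<not> ?thesis"
    then obtain m n where "dist x ((g ^^ m) q1) < 4 * \<delta>" "dist x ((g ^^ n) q2) < 4 * \<delta>"
      using q12 by (meson not_le)
    then have "dist ((g ^^ m) q1) ((g ^^ n) q2) < d"
      using dist_triangle3[of "(g ^^ m) q1" "(g ^^ n) q2" x] by (simp add: \<delta>_def)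
    then show False using sep[of m n] by linarith
  qed
  have "\<exists>y\<in>V \<inter> U. \<exists>n\<ge>1. dist ((g ^^ n) x) ((g ^^ n) y) > \<delta>"
    if x: "x \<in> V" "x \<in> interior U" for x U
  proof -
    define S where "S = V \<inter> (interior U \<inter> ball x \<delta>)"
    have S: "openin (top_of_set V) S" "S \<noteq> {}"
      using x \<delta> by (auto simp: S_def openin_open_Int)
    have SU: "y \<in> V \<inter> U" if "y \<in> S" for y
      using that interior_subset by (auto simp: S_def)
    obtain p where p: "p \<in> P" "p \<in> S" using openin_ex_dense[OF dense S] by blast
    then obtain k where k: "k \<ge> 1" "(g ^^ k) p = p" using per by (auto simp: S_def)
    obtain q where q: "q \<in> V" "\<And>n. dist x ((g ^^ n) q) \<ge> 4 * \<delta>" using far by blast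
    \<comment> \<open>Points that shadow the orbit of \<open>q\<close> for a full period of
      \<open>p\<close>. Only finitely many iterates are constrained, so continuity makes this set
      relatively open; it contains \<open>q\<close>.\<close>
    define T where "T = (\<Inter>i\<in>{..k}. V \<inter> (g ^^ i) -` ball ((g ^^ i) q) \<delta>)"
    have "openin (top_of_set V) T"
      unfolding T_def
      by (intro openin_INT2 continuous_openin_preimage_gen continuous_on_funpow cont inv) auto
    moreover have "T \<noteq> {}" using q(1) \<delta> by (auto simp: T_def)
    ultimately obtain n y where y: "y \<in> S" "(g ^^ n) y \<in> T" using trans[OF S] by blast
    \<comment> \<open>The waiting time after \<open>n\<close> up to the next multiple
      \<open>N\<close> of \<open>k\<close>. It lies between 1 and \<open>k\<close>, so the shadowing
      still holds at time \<open>N\<close>, and \<open>N\<close> is positive even if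
      \<open>n\<close> is 0.\<close>
    define i where "i = k - n mod k"
    define N where "N = k * (n div k + 1)"
    have "n mod k \<le> k" using k(1) by (simp add: less_imp_le)
    then have N: "N = i + n"
      using mult_div_mod_eq[of k n] unfolding N_def i_def distrib_left by linarith
    have "(g ^^ N) y = (g ^^ i) ((g ^^ n) y)" by (simp add: N funpow_add)
    then have 1: "dist ((g ^^ i) q) ((g ^^ N) y) < \<delta>" using y(2) by (auto simp: T_def i_def)
    have "(g ^^ N) p = p" unfolding N_def by (rule funpow_mult_fixed[OF k(2)])
    then have 2: "dist x ((g ^^ N) p) < \<delta>"
      using p(2) by (simp add: S_def)
    have "2 * \<delta> < dist ((g ^^ N) p) ((g ^^ N) y)"
      using 1 2 q(2)[of i] dist_triangle[of x "(g ^^ i) q" "(g ^^ N) p"]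
        dist_triangle2[of "(g ^^ N) p" "(g ^^ i) q" "(g ^^ N) y"] by linarith
    then have "dist ((g ^^ N) x) ((g ^^ N) p) > \<delta> \<or> dist ((g ^^ N) x) ((g ^^ N) y) > \<delta>"
      using dist_triangle3[of "(g ^^ N) p" "(g ^^ N) y" "(g ^^ N) x"] by linarith
    moreover have "N \<ge> 1" using k(1) by (simp add: N_def)
    ultimately show ?thesis using SU[OF p(2)] SU[OF y(1)] by blast
  qed
  with \<delta> show ?thesis by blast
qed

lemma continuous_on_iter0:
  fixes f :: "nat \<Rightarrow> 'a::topological_space \<Rightarrow> 'a"
  assumes "\<And>n. continuous_on V (f n)" "\<And>n. iter0 f n ` V \<subseteq> V"
  shows "continuous_on V (iter0 f n)"
proof (induction n)
  case (Suc n)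
  show ?case
    using continuous_on_compose[OF Suc continuous_on_subset[OF assms(1) assms(2)]] by simp
qed (simp add: id_def)

lemma limit_along_periodic_orbit:
  fixes f :: "nat \<Rightarrow> 'a::t2_space \<Rightarrow> 'a"
  assumes "k_periodic_point D f k p"
    and lim: "(\<lambda>m. f m (iter0 f n p)) \<longlonglongrightarrow> y"
  shows "y = iter0 f (Suc n) p"
proof -
  have k: "k \<ge> 1" and per: "\<And>n. iter0 f (n + k) p = iter0 f n p"
    using assms(1) by (auto simp: k_periodic_point_def)
  have per': "iter0 f (n + j * k) p = iter0 f n p" for n j
    by (induction j) (simp_all add: per add.assoc[symmetric] add.commute[of k])
  have "f (n + j * k) (iter0 f n p) = iter0 f (Suc n) p" for j
    using per'[of "Suc n" j] per'[of n j] by simp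
  moreover have "strict_mono (\<lambda>j. n + j * k)" using k by (auto intro!: strict_monoI)
  \<comment> \<open>The indices \<open>n + j * k\<close> select a constant subsequence, which
    determines the limit.\<close>
  ultimately have "(\<lambda>j::nat. iter0 f (Suc n) p) \<longlonglongrightarrow> y"
    using LIMSEQ_subseq_LIMSEQ[OF lim] by (fastforce simp: o_def)
  then show ?thesis by (simp add: LIMSEQ_const_iff)
qed

theorem theorem4p1:
  fixes D :: "nat \<Rightarrow> 'a::metric_space set"
    and f :: "nat \<Rightarrow> 'a \<Rightarrow> 'a"
    and g :: "'a \<Rightarrow> 'a"
    and V :: "'a set"
  assumes "nonautonomous_system D f"
    and "totally_invariant D f V"
    and "infinite V"
    and "\<And>x. x \<in> V \<Longrightarrow> (\<lambda>n. f n x) \<longlonglongrightarrow> g x"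
    and "\<And>n. continuous_on V (f n)"
    and "continuous_on V g"
    and "topologically_transitive_in D f V"
    and "V \<subseteq> closure (periodic_points D f \<inter> V)"
  shows "sensitive_in D f V"
proof -
  have inv: "iter0 f n ` V \<subseteq> V" for n
    using assms(2) by (simp add: totally_invariant_def)
  have iter_in: "iter0 f n x \<in> V" if "x \<in> V" for n x
    using inv that by blast
  have cont: "continuous_on V (iter0 f n)" for n
    using continuous_on_iter0 assms(5) inv by blast
  have step: "g (iter0 f n x) = iter0 f (Suc n) x" if x: "x \<in> V" for n x
  proof (rule ccontr)
    assume neq: "\<not> ?thesis"
    \<comment> \<open>The set where the identity fails is relatively open, as a continuous distance
      is nonzero there. If it were nonempty, it would contain a periodic point, where the identity
      does hold.\<close>
    let ?S = "{x \<in> V. g (iter0 f n x) \<noteq> iter0 f (Suc n) x}"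
    have "continuous_on V (\<lambda>x. g (iter0 f n x))"
      using continuous_on_compose2[OF assms(6) cont inv] .
    then have "continuous_on V (\<lambda>x. dist (g (iter0 f n x)) (iter0 f (Suc n) x))"
      using cont by (rule continuous_on_dist)
    then have "openin (top_of_set V)
        (V \<inter> (\<lambda>x. dist (g (iter0 f n x)) (iter0 f (Suc n) x)) -` (- {0}))"
      by (rule continuous_openin_preimage_gen) auto
    moreover have "V \<inter> (\<lambda>x. dist (g (iter0 f n x)) (iter0 f (Suc n) x)) -` (- {0}) = ?S"
      by auto
    ultimately obtain p where p: "p \<in> periodic_points D f" "p \<in> ?S"
      using openin_ex_dense[OF assms(8), of ?S] x neq by auto
    then obtain k where "k_periodic_point D f k p" by (auto simp: periodic_points_def)
    moreover have "(\<lambda>m. f m (iter0 f n p)) \<longlonglongrightarrow> g (iter0 f n p)"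
      using p(2) by (intro assms(4) iter_in) simp
    ultimately show False
      using limit_along_periodic_orbit p(2) by blast
  qed
  \<comment> \<open>The case \<open>n = 0\<close> of \<open>step\<close> says that \<open>g\<close>
    agrees with \<open>f 0\<close> on \<open>V\<close>.\<close>
  have ginv: "g ` V \<subseteq> V"
    using step[of _ 0] iter_in[of _ "Suc 0"] by auto
  have iter_eq: "iter0 f n x = (g ^^ n) x" if "x \<in> V" for n x
    using step[OF that, symmetric] by (induction n) (simp_all del: iter0.simps(2))
  have V: "V \<noteq> {}" "V \<subseteq> D 0"
    using assms(7) by (auto simp: topologically_transitive_in_def)
  have "\<exists>n. (g ^^ n) ` S \<inter> T \<noteq> {}"
    if ST: "openin (top_of_set V) S" "S \<noteq> {}" "openin (top_of_set V) T" "T \<noteq> {}" for S T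
  proof -
    obtain n where n: "iter0 f n ` S \<inter> T \<noteq> {}"
      using assms(7) ST unfolding topologically_transitive_in_def by meson
    have "iter0 f n ` S = (g ^^ n) ` S"
      using iter_eq openin_imp_subset[OF ST(1)] by (intro image_cong) auto
    with n show ?thesis by metis
  qed
  moreover have "\<exists>k\<ge>1. (g ^^ k) p = p" if "p \<in> periodic_points D f \<inter> V" for p
  proof -
    obtain k where "k \<ge> 1" "iter0 f (0 + k) p = iter0 f 0 p"
      using \<open>p \<in> periodic_points D f \<inter> V\<close>
      unfolding periodic_points_def k_periodic_point_def by blast
    with that show ?thesis using iter_eq[of p k] by auto
  qed
  ultimately have "\<exists>\<delta>>0. \<forall>x\<in>V. \<forall>U. x \<in> interior U \<longrightarrow>
      (\<exists>y\<in>V \<inter> U. \<exists>n\<ge>1. dist ((g ^^ n) x) ((g ^^ n) y) > \<delta>)"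
    using Banks_sensitivity[OF assms(3,6) ginv _ assms(8)] by blast
  with V show ?thesis
    unfolding sensitive_in_def by (simp add: iter_eq Bex_def cong: conj_cong)
qed

end
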